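(* Let $k\ge 1$ and $n\ge k$ be integers, and let $\mathcal{F}$ be any finite list of $k$-sparse split sets in $\mathbb{R}^n$. Then $C(\mathcal{F})\ge\left\lfloor\frac{k}{2}\right\rfloor$.
   Context: For $\pi\in\mathbb{Z}^n$ and $\eta\in\mathbb{Z}$, the split set is the open set $S(\pi,\eta):=\{x\in\mathbb{R}^n \mid \eta<\pi^{\top}x<\eta+1\}$. Let $\|\pi\|_0$ denote the number of non-zero entries of $\pi$; the split set $S(\pi,\eta)$ is called $k$-sparse if $\|\pi\|_0\le k$. A collection of split sets $\{S(\pi^i,\eta^i)\}_{i=1}^p$ in $\mathbb{R}^n$ dominates a split set $S(\pi^0,\eta^0)\subseteq\mathbb{R}^n$ if $$\Big(\bigcup_{i=1}^p S(\pi^i,\eta^i)\Big)\cap[0,1]^n\supseteq S(\pi^0,\eta^0)\cap[0,1]^n.$$ Covering number: let $\mathcal{F}$ be a finite list of $k$-sparse split sets in $\mathbb{R}^n$. For a $k$-sparse split set $S$ in $\mathbb{R}^n$, let $\mathcal{F}(S)$ be the smallest number of split sets from $\mathcal{F}$ that (together) dominate $S$, with $\mathcal{F}(S)=+\infty$ if no collection of split sets from $\mathcal{F}$ dominates $S$. The covering number of $\mathcal{F}$ is $$C(\mathcal{F}):=\max\{\mathcal{F}(S)\mid S\text{ is a }k\text{-sparse split set in }\mathbb{R}^n\}.$$ *)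

theory Defs
  imports "HOL-Analysis.Analysis" "HOL-Library.Extended_Nat"
begin

definition split_set :: "int ^ 'n \<Rightarrow> int \<Rightarrow> (real ^ 'n) set" where
  "split_set \<pi> \<eta> =
     {x. real_of_int \<eta> < (\<chi> i. real_of_int (\<pi> $ i)) \<bullet> x \<and>
         (\<chi> i. real_of_int (\<pi> $ i)) \<bullet> x < real_of_int \<eta> + 1}"

definition norm0 :: "int ^ 'n \<Rightarrow> nat" where
  "norm0 \<pi> = card {i. \<pi> $ i \<noteq> 0}"

definition sparse_split_set :: "nat \<Rightarrow> (real ^ 'n) set \<Rightarrow> bool" where
  "sparse_split_set k S \<longleftrightarrow> (\<exists>\<pi> \<eta>. norm0 \<pi> \<le> k \<and> S = split_set \<pi> \<eta>)"

definition dominates :: "(real ^ 'n) set set \<Rightarrow> (real ^ 'n) set \<Rightarrow> bool" where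
  "dominates \<T> S \<longleftrightarrow> S \<inter> cbox 0 1 \<subseteq> \<Union>\<T> \<inter> cbox 0 1"

text \<open>The infimum of the empty set is \<open>\<infinity>\<close> in \<^typ>\<open>enat\<close>, and the infimum of a
  non-empty set is its least element.\<close>

definition dominating_number :: "(real ^ 'n) set list \<Rightarrow> (real ^ 'n) set \<Rightarrow> enat" where
  "dominating_number \<F> S = Inf {enat (card \<T>) | \<T>. \<T> \<subseteq> set \<F> \<and> dominates \<T> S}"

definition covering_number :: "nat \<Rightarrow> (real ^ 'n) set list \<Rightarrow> enat" where
  "covering_number k \<F> = Max {dominating_number \<F> S | S. sparse_split_set k S}"

text \<open>The maximum in \<^const>\<open>covering_number\<close> ranges over a finite non-empty set, so it exists.\<close>

lemma dominating_number_cases: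
  "dominating_number \<F> S \<in> insert \<infinity> (enat ` {..card (set \<F>)})"
proof -
  let ?A = "{enat (card \<T>) | \<T>. \<T> \<subseteq> set \<F> \<and> dominates \<T> S}"
  show ?thesis
  proof (cases "?A = {}")
    case True
    then show ?thesis
      unfolding dominating_number_def True by (simp add: Inf_enat_def)
  next
    case False
    then have "Inf ?A \<in> ?A"
      by (metis (no_types, lifting) Inf_enat_def LeastI ex_in_conv)
    then obtain \<T> where "Inf ?A = enat (card \<T>)" "\<T> \<subseteq> set \<F>"
      by blast
    then show ?thesis
      unfolding dominating_number_def by (auto simp: card_mono)
  qed
qed

lemma finite_dominating_numbers:
  "finite {dominating_number \<F> S | S. sparse_split_set k S}"
proof (rule finite_subset)
  show "{dominating_number \<F> S | S. sparse_split_set k S} \<subseteq> insert \<infinity> (enat ` {..card (set \<F>)})"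
    using dominating_number_cases[of \<F>] by (auto simp del: insert_iff)
qed simp

lemma dominating_numbers_nonempty:
  "{dominating_number \<F> S | S. sparse_split_set k S} \<noteq> {}"
proof -
  have "sparse_split_set k (split_set 0 0)"
    unfolding sparse_split_set_def by (rule exI[of _ 0], rule exI[of _ 0]) (simp add: norm0_def)
  then show ?thesis by blast
qed

end

theory Submission
  imports Defs
begin

text \<open>
  Write \<open>t = k div 2\<close>.  A split set that is not dominated by fewer than \<open>t\<close> members of the family
  is built from \<open>t\<close> disjoint pairs of coordinates \<open>(j, g j)\<close>, \<open>j \<in> A\<close>: its normal \<open>\<pi>\<close> has entries
  \<open>a j\<close> and \<open>- a j\<close> on the pair of \<open>j\<close> and vanishes elsewhere, and the split set is
  \<open>0 < \<pi> \<bullet> x < 1\<close>.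

  Two observations drive the argument.  An integral point lies in no split set, and neither does a
  point \<open>z + d\<close> with \<open>z\<close> integral and \<open>d\<close> orthogonal to the normal, since there the normal takes an
  integer value.  Moreover a \<open>0/1\<close> vector \<open>z\<close> that is constant on every pair satisfies
  \<open>\<pi> \<bullet> z = 0\<close>.  So, given a subfamily with normals \<open>\<sigma>\<close>, it suffices to find \<open>d\<close> such that
  \<open>\<sigma> \<bullet> d = 0\<close> for all these \<open>\<sigma>\<close>, \<open>\<pi> \<bullet> d > 0\<close>, and both entries of \<open>d\<close> on a pair have the same sign.
  For then \<open>z\<close> can be taken to be \<open>1\<close> on the pairs where \<open>d\<close> is negative and \<open>0\<close> elsewhere, and
  \<open>z + s d\<close>, for small \<open>s > 0\<close>, is a point of the cube that lies in the split set of \<open>\<pi>\<close> but in no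
  member of the subfamily (\<open>uncovered_point\<close>).

  The sign condition is enforced by fixing the ratio of the two entries in advance: let \<open>d\<close> be
  \<open>(p j, 2 * p j)\<close> on the pair of \<open>j\<close>.  Fewer than \<open>t\<close> homogeneous equations \<open>\<sigma> \<bullet> d = 0\<close> in the \<open>t\<close>
  unknowns \<open>p j\<close> have a non-zero solution (\<open>exists_common_direction\<close>).  As
  \<open>\<pi> \<bullet> d = - (\<Sum>j\<in>A. a j * p j)\<close>, only \<open>\<Sum>j\<in>A. a j * p j \<noteq> 0\<close> is left to be arranged, up to replacing
  \<open>p\<close> by \<open>- p\<close>.  The solution \<open>p\<close> is selected once for each subfamily, without reference to \<open>a\<close>, and
  there are finitely many subfamilies, so a single integral \<open>a\<close> serves all of them
  (\<open>exists_int_vector_avoiding\<close>).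
\<close>

section \<open>Integral vectors off finitely many hyperplanes\<close>

text \<open>
  By induction on the set of normals.  If \<open>a\<close> works for \<open>P\<close> but is orthogonal to a new \<open>q\<close>, it is
  replaced by \<open>N * a + e\<close>, where \<open>e\<close> is a unit vector with \<open>q \<bullet> e \<noteq> 0\<close>: this is never orthogonal
  to \<open>q\<close>, and each \<open>p \<in> P\<close> rules out only one value of \<open>N\<close>.
\<close>

lemma exists_int_vector_avoiding:
  fixes P :: "(real ^ 'n) set"
  assumes "finite P" and "0 \<notin> P"
  shows "\<exists>a :: 'n \<Rightarrow> int. \<forall>p\<in>P. (\<Sum>j\<in>UNIV. real_of_int (a j) * p $ j) \<noteq> 0"
  using assms
proof (induction P rule: finite_induct)
  case empty
  then show ?case by simp
next
  case (insert q P)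
  define dot where "dot = (\<lambda>(a :: 'n \<Rightarrow> int) (p :: real ^ 'n). \<Sum>j\<in>UNIV. real_of_int (a j) * p $ j)"
  obtain a where a: "\<And>p. p \<in> P \<Longrightarrow> dot a p \<noteq> 0"
    using insert unfolding dot_def by auto
  show ?case
  proof (cases "dot a q = 0")
    case False
    then show ?thesis using a unfolding dot_def by auto
  next
    case True
    have "q \<noteq> 0" using insert.prems by auto
    then obtain i where i: "q $ i \<noteq> 0" by (auto simp: vec_eq_iff)
    have "finite ((\<lambda>p. - (p $ i) / dot a p) ` P)" using insert.hyps by simp
    moreover have "infinite (range real)"
      using finite_imageD[of real UNIV] inj_of_nat by auto
    ultimately have "\<not> range real \<subseteq> (\<lambda>p. - (p $ i) / dot a p) ` P"
      using finite_subset by blast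
    then obtain N :: nat where N: "real N \<notin> (\<lambda>p. - (p $ i) / dot a p) ` P"
      by blast
    define b where "b = (\<lambda>j. int N * a j + (if j = i then 1 else 0))"
    have b: "dot b p = real N * dot a p + p $ i" for p
    proof -
      have "dot b p = (\<Sum>j\<in>UNIV. real N * (real_of_int (a j) * p $ j) + (if j = i then p $ j else 0))"
        unfolding dot_def b_def by (intro sum.cong) (auto simp: algebra_simps)
      also have "\<dots> = real N * dot a p + p $ i"
        by (simp add: dot_def sum.distrib sum_distrib_left)
      finally show ?thesis .
    qed
    have "dot b p \<noteq> 0" if "p \<in> P" for p
    proof
      assume "dot b p = 0"
      then have "real N = - (p $ i) / dot a p"
        using a[OF that] b[of p] by (simp add: field_simps)
      then show False using N that by blast
    qed
    moreover have "dot b q \<noteq> 0" using True i b by simp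
    ultimately show ?thesis unfolding dot_def by blast
  qed
qed

section \<open>Vectors on paired coordinates\<close>

text \<open>Here \<open>g j\<close> is the partner of \<open>j \<in> A\<close>.  The pairs \<open>(j, g j)\<close> are disjoint when \<open>g\<close> is injective
  on \<open>A\<close> and sends \<open>A\<close> into its complement.  The normal, the point and the direction of the proof
  are all vectors of this shape.\<close>

definition paired :: "'n set \<Rightarrow> ('n \<Rightarrow> 'n) \<Rightarrow> ('n \<Rightarrow> 'a::zero) \<Rightarrow> ('n \<Rightarrow> 'a) \<Rightarrow> 'a ^ 'n" where
  "paired A g u w =
     (\<chi> i. if i \<in> A then u i else if i \<in> g ` A then w (inv_into A g i) else 0)"

lemma inner_paired:
  fixes v :: "real ^ 'n"
  assumes "inj_on g A" and "g ` A \<inter> A = {}"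
  shows "v \<bullet> paired A g u w = (\<Sum>j\<in>A. v $ j * u j + v $ g j * w j)"
proof -
  let ?f = "\<lambda>i. v $ i * paired A g u w $ i"
  have "v \<bullet> paired A g u w = (\<Sum>i\<in>UNIV. ?f i)"
    by (simp add: inner_vec_def)
  also have "\<dots> = (\<Sum>i\<in>A \<union> g ` A. ?f i)"
    by (intro sum.mono_neutral_right) (auto simp: paired_def)
  also have "\<dots> = (\<Sum>i\<in>A. ?f i) + (\<Sum>i\<in>g ` A. ?f i)"
    using assms by (intro sum.union_disjoint) (auto intro: finite_subset)
  also have "(\<Sum>i\<in>g ` A. ?f i) = (\<Sum>j\<in>A. ?f (g j))"
    using assms by (simp add: sum.reindex)
  also have "\<dots> = (\<Sum>j\<in>A. v $ g j * w j)"
    using assms by (intro sum.cong) (auto simp: paired_def)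
  also have "(\<Sum>i\<in>A. ?f i) = (\<Sum>i\<in>A. v $ i * u i)"
    by (intro sum.cong) (auto simp: paired_def)
  finally show ?thesis by (simp add: sum.distrib)
qed

lemma paired_in_unit_cube:
  fixes u w :: "'n::finite \<Rightarrow> real"
  assumes "\<And>j. j \<in> A \<Longrightarrow> 0 \<le> u j \<and> u j \<le> 1" and "\<And>j. j \<in> A \<Longrightarrow> 0 \<le> w j \<and> w j \<le> 1"
  shows "paired A g u w \<in> cbox 0 1"
  using assms by (auto simp: mem_box_cart paired_def inv_into_into)

lemma of_int_paired:
  "(\<chi> i. real_of_int (paired A g u w $ i)) =
     paired A g (\<lambda>j. real_of_int (u j)) (\<lambda>j. real_of_int (w j))"
  by (auto simp: vec_eq_iff paired_def)

lemma norm0_paired_le: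
  fixes A :: "'n::finite set"
  shows "norm0 (paired A g u w) \<le> 2 * card A"
proof -
  have "norm0 (paired A g u w) \<le> card (A \<union> g ` A)"
    unfolding norm0_def by (intro card_mono) (auto simp: paired_def split: if_splits)
  also have "\<dots> \<le> card A + card (g ` A)" by (rule card_Un_le)
  also have "\<dots> \<le> 2 * card A" using card_image_le[of A g] by simp
  finally show ?thesis .
qed

section \<open>A point outside a small subfamily\<close>

text \<open>Each sum is \<open>v S \<bullet> d\<close> for the vector \<open>d\<close> with entries \<open>p $ j\<close> and \<open>2 * p $ j\<close> on the pair
  of \<open>j\<close>.  There are fewer equations than coordinates: less than \<open>card A\<close> from the \<open>v S\<close>, and one
  for each coordinate outside \<open>A\<close>.  The ratio \<open>2\<close> could be any positive number other than \<open>1\<close>: its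
  sign gives both entries of a pair the same sign, and with ratio \<open>1\<close> the direction would be
  orthogonal to every normal with opposite entries on the pairs.\<close>

lemma exists_common_direction:
  fixes v :: "'b \<Rightarrow> real ^ 'n" and g :: "'n \<Rightarrow> 'n"
  assumes "finite \<T>" and "card \<T> < card A"
  shows "\<exists>p. p \<noteq> 0 \<and> (\<forall>j. j \<notin> A \<longrightarrow> p $ j = 0) \<and>
           (\<forall>S\<in>\<T>. (\<Sum>j\<in>A. v S $ j * p $ j + v S $ g j * (2 * p $ j)) = 0)"
proof -
  define r where "r = (\<lambda>S. \<chi> j. if j \<in> A then v S $ j + 2 * v S $ g j else 0)"
  define C where "C = r ` \<T> \<union> (\<lambda>j. axis j (1::real)) ` (- A)"
  have "finite C" using assms unfolding C_def by simp
  have "dim C \<le> card C" using dim_le_card'[OF \<open>finite C\<close>] .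
  also have "\<dots> \<le> card (r ` \<T>) + card ((\<lambda>j. axis j (1::real)) ` (- A))"
    unfolding C_def by (rule card_Un_le)
  also have "\<dots> \<le> card \<T> + card (- A)"
    using assms by (intro add_mono card_image_le) auto
  also have "\<dots> < card A + card (- A)" using assms by simp
  also have "\<dots> = CARD('n)"
    by (metis Compl_disjoint Compl_partition card_Un_disjoint finite)
  finally have "dim C < DIM(real ^ 'n)" by simp
  then obtain p where "p \<noteq> 0" and p: "\<And>y. y \<in> span C \<Longrightarrow> orthogonal p y"
    using orthogonal_to_subspace_exists by metis
  have "p $ j = 0" if "j \<notin> A" for j
    using p[of "axis j 1"] that by (auto simp: C_def span_base orthogonal_def inner_axis)
  moreover have "(\<Sum>j\<in>A. v S $ j * p $ j + v S $ g j * (2 * p $ j)) = 0" if "S \<in> \<T>" for S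
  proof -
    have "(\<Sum>j\<in>A. v S $ j * p $ j + v S $ g j * (2 * p $ j)) = (\<Sum>j\<in>UNIV. p $ j * r S $ j)"
      by (intro sum.mono_neutral_cong_left) (auto simp: r_def algebra_simps)
    also have "\<dots> = p \<bullet> r S" by (simp add: inner_vec_def)
    also have "\<dots> = 0" using p[of "r S"] that by (auto simp: C_def span_base orthogonal_def)
    finally show ?thesis .
  qed
  ultimately show ?thesis using \<open>p \<noteq> 0\<close> by blast
qed

text \<open>The point is \<open>z + s d\<close> with \<open>d\<close> as above.  The assumption says that \<open>d\<close> has a positive product
  with the normal \<open>\<pi>\<close>, because \<open>\<pi> \<bullet> d = (\<Sum>j\<in>A. a j * p $ j - a j * (2 * p $ j))\<close>.\<close>

lemma uncovered_point_of_neg: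
  fixes p :: "real ^ 'n" and a :: "'n \<Rightarrow> int"
  assumes g: "inj_on g A" "g ` A \<inter> A = {}"
    and neg: "(\<Sum>j\<in>A. real_of_int (a j) * p $ j) < 0"
  shows "\<exists>x\<in>cbox 0 1. x \<in> split_set (paired A g a (\<lambda>j. - a j)) 0 \<and>
           (\<forall>\<sigma> \<eta>. (\<Sum>j\<in>A. real_of_int (\<sigma> $ j) * p $ j + real_of_int (\<sigma> $ g j) * (2 * p $ j)) = 0
              \<longrightarrow> x \<notin> split_set \<sigma> \<eta>)"
proof -
  define D where "D = - (\<Sum>j\<in>A. real_of_int (a j) * p $ j)"
  define B where "B = (\<Sum>j\<in>UNIV. \<bar>p $ j\<bar>)"
  \<comment> \<open>small enough for \<open>s * (\<pi> \<bullet> d) < 1\<close> and for all entries of \<open>s d\<close> to be at most \<open>1\<close> in modulus\<close>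
  define s where "s = 1 / (1 + 2 * B + D)"
  have D: "D > 0" using neg by (simp add: D_def)
  have B: "B \<ge> 0" by (simp add: B_def sum_nonneg)
  have s: "s > 0" using D B by (simp add: s_def)
  have sD: "s * D < 1" using D B by (simp add: s_def)
  have sp: "2 * (s * \<bar>p $ j\<bar>) \<le> 1" for j
  proof -
    have "\<bar>p $ j\<bar> \<le> B" unfolding B_def by (rule member_le_sum) auto
    then show ?thesis using D B by (simp add: s_def)
  qed
  \<comment> \<open>the corner of the cube from which \<open>d\<close> points into the cube; equal on both members of a pair\<close>
  define z where "z = (\<lambda>j. if p $ j < 0 then 1 else 0 :: int)"
  define u where "u = (\<lambda>j. real_of_int (z j) + s * p $ j)"
  define w where "w = (\<lambda>j. real_of_int (z j) + s * (2 * p $ j))"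
  define x where "x = paired A g u w"
  \<comment> \<open>the first summand is an integer, and it vanishes for \<open>\<pi>\<close>; the second is \<open>s * (\<sigma> \<bullet> d)\<close>\<close>
  have inner_x: "(\<chi> i. real_of_int (\<sigma> $ i)) \<bullet> x =
      real_of_int (\<Sum>j\<in>A. (\<sigma> $ j + \<sigma> $ g j) * z j) +
      s * (\<Sum>j\<in>A. real_of_int (\<sigma> $ j) * p $ j + real_of_int (\<sigma> $ g j) * (2 * p $ j))"
    for \<sigma> :: "int ^ 'n"
    unfolding x_def inner_paired[OF g] sum_distrib_left of_int_sum sum.distrib[symmetric]
    by (intro sum.cong) (auto simp: u_def w_def algebra_simps)
  have "x \<in> cbox 0 1"
    unfolding x_def
  proof (rule paired_in_unit_cube)
    fix j
    have "0 \<le> s * p $ j" if "\<not> p $ j < 0" using that s by simp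
    moreover have "s * p $ j \<le> 0" if "p $ j < 0" using that s by (simp add: mult_le_0_iff)
    moreover have "2 * \<bar>s * p $ j\<bar> \<le> 1" using sp[of j] s by (simp add: abs_mult)
    ultimately show "0 \<le> u j \<and> u j \<le> 1" "0 \<le> w j \<and> w j \<le> 1"
      by (auto simp: u_def w_def z_def)
  qed
  moreover have "x \<in> split_set (paired A g a (\<lambda>j. - a j)) 0"
  proof -
    let ?\<pi> = "paired A g a (\<lambda>j. - a j)"
    have 1: "?\<pi> $ j = a j" "?\<pi> $ g j = - a j" if "j \<in> A" for j
      using that g by (auto simp: paired_def)
    have "(\<chi> i. real_of_int (?\<pi> $ i)) \<bullet> x = s * D"
      unfolding inner_x D_def by (simp add: 1 sum_negf[symmetric] mult.commute)
    then show ?thesis using s D sD by (simp add: split_set_def)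
  qed
  moreover have "x \<notin> split_set \<sigma> \<eta>"
    if "(\<Sum>j\<in>A. real_of_int (\<sigma> $ j) * p $ j + real_of_int (\<sigma> $ g j) * (2 * p $ j)) = 0"
    for \<sigma> \<eta>
  proof -
    have "(\<chi> i. real_of_int (\<sigma> $ i)) \<bullet> x =
        real_of_int (\<Sum>j\<in>A. (\<sigma> $ j + \<sigma> $ g j) * z j)"
      unfolding inner_x that by simp
    then show ?thesis unfolding split_set_def by (simp del: of_int_sum)
  qed
  ultimately show ?thesis by blast
qed

text \<open>The equations on \<open>\<sigma>\<close> are invariant under negating \<open>p\<close>, so only the vanishing of
  \<open>\<Sum>j\<in>A. a j * p $ j\<close> matters, not its sign.\<close>

lemma uncovered_point:
  fixes p :: "real ^ 'n" and a :: "'n \<Rightarrow> int"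
  assumes g: "inj_on g A" "g ` A \<inter> A = {}"
    and nz: "(\<Sum>j\<in>A. real_of_int (a j) * p $ j) \<noteq> 0"
  shows "\<exists>x\<in>cbox 0 1. x \<in> split_set (paired A g a (\<lambda>j. - a j)) 0 \<and>
           (\<forall>\<sigma> \<eta>. (\<Sum>j\<in>A. real_of_int (\<sigma> $ j) * p $ j + real_of_int (\<sigma> $ g j) * (2 * p $ j)) = 0
              \<longrightarrow> x \<notin> split_set \<sigma> \<eta>)"
proof (cases "(\<Sum>j\<in>A. real_of_int (a j) * p $ j) < 0")
  case True
  then show ?thesis by (rule uncovered_point_of_neg[OF g])
next
  case False
  then have "(\<Sum>j\<in>A. real_of_int (a j) * (- p) $ j) < 0"
    using nz by (simp add: sum_negf)
  moreover have "(\<Sum>j\<in>A. real_of_int (\<sigma> $ j) * (- p) $ j + real_of_int (\<sigma> $ g j) * (2 * (- p) $ j))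
      = - (\<Sum>j\<in>A. real_of_int (\<sigma> $ j) * p $ j + real_of_int (\<sigma> $ g j) * (2 * p $ j))"
    for \<sigma> :: "int ^ 'n"
    unfolding sum_negf[symmetric] by (intro sum.cong) auto
  ultimately show ?thesis using uncovered_point_of_neg[OF g, of a "- p"] by simp
qed

section \<open>A split set that needs many others\<close>

lemma exists_disjoint_pairs:
  assumes "2 * t \<le> CARD('n::finite)"
  shows "\<exists>(A :: 'n set) g. card A = t \<and> inj_on g A \<and> g ` A \<inter> A = {}"
proof -
  obtain A :: "'n set" where A: "card A = t"
    using obtain_subset_with_card_n[of t "UNIV :: 'n set"] assms by auto
  have "card A \<le> card (- A)"
    using assms A by (simp add: Compl_eq_Diff_UNIV card_Diff_subset)
  then obtain g where "inj_on g A" "g ` A \<subseteq> - A"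
    using card_le_inj[of A "- A"] by auto
  then show ?thesis using A by blast
qed

text \<open>The order of the choices matters: the directions \<open>p \<T>\<close> depend only on the pairs and on the
  normals of the family, and \<open>a\<close> is chosen after all of them.\<close>

lemma exists_hard_split_set:
  fixes \<F> :: "(real ^ 'n) set set"
  assumes "finite \<F>" and split: "\<And>S. S \<in> \<F> \<Longrightarrow> \<exists>\<pi> \<eta>. S = split_set \<pi> \<eta>"
    and "2 * t \<le> CARD('n)"
  shows "\<exists>S. sparse_split_set (2 * t) S \<and> (\<forall>\<T>\<subseteq>\<F>. dominates \<T> S \<longrightarrow> t \<le> card \<T>)"
proof -
  obtain A :: "'n set" and g where A: "card A = t" and g: "inj_on g A" "g ` A \<inter> A = {}"
    using exists_disjoint_pairs assms(3) by blast
  obtain \<sigma> \<eta> where S: "\<And>S. S \<in> \<F> \<Longrightarrow> S = split_set (\<sigma> S) (\<eta> S)"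
    using split by metis
  define small where "small = {\<T>. \<T> \<subseteq> \<F> \<and> card \<T> < t}"
  define ok where "ok = (\<lambda>\<T> p. p \<noteq> 0 \<and> (\<forall>j. j \<notin> A \<longrightarrow> p $ j = 0) \<and>
      (\<forall>S\<in>\<T>. (\<Sum>j\<in>A. real_of_int (\<sigma> S $ j) * p $ j + real_of_int (\<sigma> S $ g j) * (2 * p $ j)) = 0))"
  have "\<exists>p. ok \<T> p" if "\<T> \<in> small" for \<T>
    using exists_common_direction[of \<T> A "\<lambda>S. \<chi> i. real_of_int (\<sigma> S $ i)" g] that A assms(1)
    by (auto simp: small_def ok_def intro: finite_subset)
  then obtain p where p: "\<And>\<T>. \<T> \<in> small \<Longrightarrow> ok \<T> (p \<T>)" by metis
  have "finite small" using assms(1) by (simp add: small_def)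
  then obtain a :: "'n \<Rightarrow> int"
    where a: "\<And>\<T>. \<T> \<in> small \<Longrightarrow> (\<Sum>j\<in>UNIV. real_of_int (a j) * p \<T> $ j) \<noteq> 0"
    using exists_int_vector_avoiding[of "p ` small"] p by (fastforce simp: ok_def)
  let ?\<pi> = "paired A g a (\<lambda>j. - a j)"
  have "\<not> dominates \<T> (split_set ?\<pi> 0)" if \<T>: "\<T> \<in> small" for \<T>
  proof -
    have "(\<Sum>j\<in>A. real_of_int (a j) * p \<T> $ j) = (\<Sum>j\<in>UNIV. real_of_int (a j) * p \<T> $ j)"
      using p[OF \<T>] by (intro sum.mono_neutral_left) (auto simp: ok_def)
    then have "(\<Sum>j\<in>A. real_of_int (a j) * p \<T> $ j) \<noteq> 0"
      using a[OF \<T>] by simp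
    from uncovered_point[OF g this]
    obtain x where x: "x \<in> cbox 0 1" "x \<in> split_set ?\<pi> 0"
      and avoid: "\<And>S. S \<in> \<T> \<Longrightarrow> x \<notin> split_set (\<sigma> S) (\<eta> S)"
      using p[OF \<T>] unfolding ok_def by blast
    have "x \<notin> \<Union>\<T>" using avoid S \<T> by (auto simp: small_def)
    then show ?thesis using x by (auto simp: dominates_def)
  qed
  moreover have "sparse_split_set (2 * t) (split_set ?\<pi> 0)"
    using norm0_paired_le[of A g a "\<lambda>j. - a j"] A by (auto simp: sparse_split_set_def)
  ultimately show ?thesis
    unfolding small_def mem_Collect_eq by (meson not_le)
qed

theorem theorem3:
  fixes k :: nat and \<F> :: "(real ^ 'n) set list"
  assumes "k \<ge> 1" and "CARD('n) \<ge> k"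
    and "\<forall>S\<in>set \<F>. sparse_split_set k S"
  shows "covering_number k \<F> \<ge> enat (k div 2)"
proof -
  have "2 * (k div 2) \<le> k" by simp
  then have le: "2 * (k div 2) \<le> CARD('n)" using assms(2) by linarith
  have "\<And>S. S \<in> set \<F> \<Longrightarrow> \<exists>\<pi> \<eta>. S = split_set \<pi> \<eta>"
    using assms(3) unfolding sparse_split_set_def by blast
  then obtain S where S: "sparse_split_set (2 * (k div 2)) S"
    and hard: "\<And>\<T>. \<T> \<subseteq> set \<F> \<Longrightarrow> dominates \<T> S \<Longrightarrow> k div 2 \<le> card \<T>"
    using exists_hard_split_set[of "set \<F>" "k div 2"] le by auto
  have "sparse_split_set k S"
    using S order_trans[OF _ \<open>2 * (k div 2) \<le> k\<close>] unfolding sparse_split_set_def by blast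
  then have "dominating_number \<F> S \<le> covering_number k \<F>"
    unfolding covering_number_def by (intro Max_ge finite_dominating_numbers) blast
  moreover have "enat (k div 2) \<le> dominating_number \<F> S"
    unfolding dominating_number_def by (intro Inf_greatest) (auto dest: hard)
  ultimately show ?thesis by (rule order_trans[rotated])
qed

end
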